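(* Let $\mathbb{K}$ be an uncountable algebraically closed field, let $x=(x_1,\ldots,x_n)$ be a vector of finitely many variables, and let $G:\mathbb{K}[[x]]^m\longrightarrow\mathbb{K}[[x]]^q$ be a textile map. Then there exists an $l\in\mathbb{N}$, depending on $G$, such that the following holds: if there exists $y(x)\in\mathbb{K}[[x]]^m$ with $$G(y(x))\equiv 0 \mod (x)^l,$$ then there exists $\tilde y(x)\in\mathbb{K}[[x]]^m$ (not required to be related to $y(x)$) with $$G(\tilde y(x))=0.$$
   Context: $\mathbb{K}[[x]]$ denotes the ring of formal power series in $x=(x_1,\ldots,x_n)$ over $\mathbb{K}$, and $(x)=(x_1,\ldots,x_n)$ denotes its maximal ideal; a congruence modulo $(x)^l$ between vectors of power series is understood componentwise. A map $G:\mathbb{K}[[x]]^m\to\mathbb{K}[[x]]^q$ is called textile if $G(y(x))$ is a vector of power series whose coefficients are polynomials in the coefficients of $y(x)$. Explicitly: writing $y(x)=(y_1(x),\ldots,y_m(x))$ with $y_i(x)=\sum_{\alpha\in\mathbb{N}^n}y_{i,\alpha}x^\alpha$, one has $$G(y(x))=\left(\sum_{\beta\in\mathbb{N}^n}G_{1,\beta}x^\beta,\ldots,\sum_{\beta\in\mathbb{N}^n}G_{q,\beta}x^\beta\right),$$ where each $G_{j,\beta}$ is a fixed polynomial with coefficients in $\mathbb{K}$ in the (infinitely many) variables $y_{i,\alpha}$, $1\le i\le m$, $\alpha\in\mathbb{N}^n$ (so each individual $G_{j,\beta}$ involves only finitely many of these variables), evaluated at the coefficients of $y(x)$. *)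

theory Defs
  imports
    "HOL-Library.Poly_Mapping"
    "HOL-Library.Countable_Set"
    "HOL-Computational_Algebra.Polynomial"
    "HOL-Analysis.Finite_Cartesian_Product"
begin

section \<open>Formal power series in finitely many variables\<close>

text \<open>
  The variables are indexed by the finite type \<open>'n\<close>, so a multi-exponent is a vector in
  \<open>nat ^ 'n\<close>, and a power series is an arbitrary family of coefficients.
\<close>

typedef (overloaded) ('k, 'n) mfps = "UNIV :: (nat ^ 'n::finite \<Rightarrow> 'k) set"
  morphisms mfps_coeff Abs_mfps
  by simp

lemma mfps_coeff_Abs [simp]: "mfps_coeff (Abs_mfps f) = f"
  by (simp add: Abs_mfps_inverse)

lemma mfps_eqI: "(\<And>\<alpha>. mfps_coeff f \<alpha> = mfps_coeff g \<alpha>) \<Longrightarrow> f = g"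
  by (metis ext mfps_coeff_inject)

instantiation mfps :: (zero, finite) zero
begin
definition "0 = Abs_mfps (\<lambda>_. 0)"
instance ..
end

instantiation mfps :: ("{zero, one}", finite) one
begin
definition "1 = Abs_mfps (\<lambda>\<alpha>. if \<alpha> = 0 then 1 else 0)"
instance ..
end

instantiation mfps :: (plus, finite) plus
begin
definition "f + g = Abs_mfps (\<lambda>\<alpha>. mfps_coeff f \<alpha> + mfps_coeff g \<alpha>)"
instance ..
end

instantiation mfps :: (uminus, finite) uminus
begin
definition "- f = Abs_mfps (\<lambda>\<alpha>. - mfps_coeff f \<alpha>)"
instance ..
end

instantiation mfps :: (minus, finite) minus
begin
definition "f - g = Abs_mfps (\<lambda>\<alpha>. mfps_coeff f \<alpha> - mfps_coeff g \<alpha>)"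
instance ..
end

instantiation mfps :: ("{comm_monoid_add, times}", finite) times
begin
definition
  "f * g = Abs_mfps (\<lambda>\<alpha>. \<Sum>(\<beta>, \<gamma>) | \<beta> + \<gamma> = \<alpha>. mfps_coeff f \<beta> * mfps_coeff g \<gamma>)"
instance ..
end

lemma mfps_coeff_simps [simp]:
  "mfps_coeff 0 \<alpha> = 0"
  "mfps_coeff 1 \<alpha> = (if \<alpha> = 0 then 1 else 0)"
  "mfps_coeff (f + g) \<alpha> = mfps_coeff f \<alpha> + mfps_coeff g \<alpha>"
  "mfps_coeff (- f') \<alpha> = - mfps_coeff f' \<alpha>"
  "mfps_coeff (h - h') \<alpha> = mfps_coeff h \<alpha> - mfps_coeff h' \<alpha>"
  by (simp_all add: zero_mfps_def one_mfps_def plus_mfps_def uminus_mfps_def minus_mfps_def)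

lemma mfps_coeff_mult:
  "mfps_coeff (f * g) \<alpha> = (\<Sum>(\<beta>, \<gamma>) | \<beta> + \<gamma> = \<alpha>. mfps_coeff f \<beta> * mfps_coeff g \<gamma>)"
  by (simp add: times_mfps_def)

lemma finite_vec_nat_le: "finite {\<beta> :: nat ^ 'n. \<forall>i. \<beta> $ i \<le> \<alpha> $ i}"
proof -
  have "finite (PiE UNIV (\<lambda>i. {..\<alpha> $ i}))"
    by (intro finite_PiE) auto
  moreover have "{\<beta> :: nat ^ 'n. \<forall>i. \<beta> $ i \<le> \<alpha> $ i} \<subseteq> vec_lambda ` (PiE UNIV (\<lambda>i. {..\<alpha> $ i}))"
  proof
    fix \<beta> :: "nat ^ 'n" assume "\<beta> \<in> {\<beta>. \<forall>i. \<beta> $ i \<le> \<alpha> $ i}"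
    then have "vec_nth \<beta> \<in> PiE UNIV (\<lambda>i. {..\<alpha> $ i})" by auto
    then show "\<beta> \<in> vec_lambda ` (PiE UNIV (\<lambda>i. {..\<alpha> $ i}))"
      by (metis image_eqI vec_lambda_eta)
  qed
  ultimately show ?thesis by (meson finite_imageI finite_subset)
qed

lemma finite_vec_nat_splits [simp, intro]: "finite {(\<beta>, \<gamma>). \<beta> + \<gamma> = (\<alpha> :: nat ^ 'n)}"
proof (rule finite_subset)
  show "finite ({\<beta>. \<forall>i. \<beta> $ i \<le> \<alpha> $ i} \<times> {\<beta>. \<forall>i. \<beta> $ i \<le> \<alpha> $ i})"
    by (intro finite_cartesian_product finite_vec_nat_le)
qed auto

instance mfps :: (comm_ring_1, finite) comm_ring_1
proof
  fix f g h :: "('a, 'b) mfps"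
  show "f * g * h = f * (g * h)"
  proof (rule mfps_eqI)
    fix \<alpha> :: "nat ^ 'b"
    let ?F = "mfps_coeff f" and ?G = "mfps_coeff g" and ?H = "mfps_coeff h"
    let ?S = "\<lambda>\<alpha> :: nat ^ 'b. {(\<beta>, \<gamma>). \<beta> + \<gamma> = \<alpha>}"
    have "mfps_coeff (f * g * h) \<alpha> =
        (\<Sum>p\<in>?S \<alpha>. \<Sum>q\<in>?S (fst p). ?F (fst q) * ?G (snd q) * ?H (snd p))"
      by (simp add: mfps_coeff_mult sum_distrib_right case_prod_unfold)
    also have "\<dots> = (\<Sum>(p, q)\<in>(SIGMA p:?S \<alpha>. ?S (fst p)). ?F (fst q) * ?G (snd q) * ?H (snd p))"
      by (intro sum.Sigma) auto
    also have "\<dots> = (\<Sum>(p, q)\<in>(SIGMA p:?S \<alpha>. ?S (snd p)). ?F (fst p) * (?G (fst q) * ?H (snd q)))"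
      by (rule sum.reindex_bij_witness[where
            i = "\<lambda>((a, bc), (b, c)). ((a + b, c), (a, b))" and
            j = "\<lambda>((ab, c), (a, b)). ((a, b + c), (b, c))"])
         (auto simp: add.assoc mult.assoc)
    also have "\<dots> = (\<Sum>p\<in>?S \<alpha>. \<Sum>q\<in>?S (snd p). ?F (fst p) * (?G (fst q) * ?H (snd q)))"
      by (intro sum.Sigma[symmetric]) auto
    also have "\<dots> = mfps_coeff (f * (g * h)) \<alpha>"
      by (simp add: mfps_coeff_mult sum_distrib_left case_prod_unfold)
    finally show "mfps_coeff (f * g * h) \<alpha> = mfps_coeff (f * (g * h)) \<alpha>" .
  qed
  show "f * g = g * f"
  proof (rule mfps_eqI)
    fix \<alpha> :: "nat ^ 'b"
    show "mfps_coeff (f * g) \<alpha> = mfps_coeff (g * f) \<alpha>"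
      unfolding mfps_coeff_mult
      by (rule sum.reindex_bij_witness[where i = prod.swap and j = prod.swap])
         (auto simp: add.commute mult.commute)
  qed
  show "1 * f = f"
  proof (rule mfps_eqI)
    fix \<alpha> :: "nat ^ 'b"
    have "mfps_coeff (1 * f) \<alpha> =
        (\<Sum>(\<beta>, \<gamma>)\<in>{(0, \<alpha>)}. mfps_coeff (1 :: ('a, 'b) mfps) \<beta> * mfps_coeff f \<gamma>)"
      unfolding mfps_coeff_mult by (rule sum.mono_neutral_right) (auto split: if_splits)
    then show "mfps_coeff (1 * f) \<alpha> = mfps_coeff f \<alpha>" by simp
  qed
  show "(f + g) * h = f * h + g * h"
    by (rule mfps_eqI)
       (simp add: mfps_coeff_mult case_prod_unfold distrib_right sum.distrib)
  have "mfps_coeff (0 :: ('a, 'b) mfps) 0 \<noteq> mfps_coeff 1 0" by simp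
  then show "(0 :: ('a, 'b) mfps) \<noteq> 1" by metis
qed (rule mfps_eqI, simp add: algebra_simps)+

definition mfps_X :: "'n \<Rightarrow> ('k::zero_neq_one, 'n::finite) mfps" where
  "mfps_X i = Abs_mfps (\<lambda>\<alpha>. if \<alpha> = axis i 1 then 1 else 0)"

section \<open>Ideals and congruences\<close>

lemma module_mult: "module ((*) :: 'a::comm_ring_1 \<Rightarrow> 'a \<Rightarrow> 'a)"
  by unfold_locales (simp_all add: algebra_simps)

definition ideal_generated :: "'a::comm_ring_1 set \<Rightarrow> 'a set" where
  "ideal_generated = module.span (*)"

definition ideal_power :: "'a::comm_ring_1 set \<Rightarrow> nat \<Rightarrow> 'a set" where
  "ideal_power I l = ideal_generated {prod_list fs | fs. length fs = l \<and> set fs \<subseteq> I}"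

definition mfps_maximal_ideal :: "('k::comm_ring_1, 'n::finite) mfps set" where
  "mfps_maximal_ideal = ideal_generated (range mfps_X)"

definition vec_cong :: "'a::comm_ring_1 ^ 'q \<Rightarrow> 'a ^ 'q \<Rightarrow> 'a set \<Rightarrow> bool" where
  "vec_cong u v I \<longleftrightarrow> (\<forall>j. u $ j - v $ j \<in> I)"

section \<open>Polynomials in arbitrarily many variables and textile maps\<close>

text \<open>
  A monomial is a finitely supported exponent function on the set \<open>'v\<close> of variables, and
  a polynomial is a finitely supported coefficient function on monomials.
\<close>

type_synonym ('v, 'k) mpoly = "('v \<Rightarrow>\<^sub>0 nat) \<Rightarrow>\<^sub>0 'k"

definition mpoly_eval :: "('v, 'k::comm_semiring_1) mpoly \<Rightarrow> ('v \<Rightarrow> 'k) \<Rightarrow> 'k" where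
  "mpoly_eval p a =
     (\<Sum>\<mu>\<in>Poly_Mapping.keys p. Poly_Mapping.lookup p \<mu> *
        (\<Prod>v\<in>Poly_Mapping.keys \<mu>. a v ^ Poly_Mapping.lookup \<mu> v))"

text \<open>
  The variable indexed by \<open>(i, \<alpha>)\<close> stands for the coefficient at \<open>\<alpha>\<close> of the \<open>i\<close>-th component.
\<close>

definition textile ::
  "(('k::comm_ring_1, 'n::finite) mfps ^ 'm \<Rightarrow> ('k, 'n) mfps ^ 'q) \<Rightarrow> bool" where
  "textile G \<longleftrightarrow>
     (\<exists>P :: 'q \<Rightarrow> nat ^ 'n \<Rightarrow> ('m \<times> (nat ^ 'n), 'k) mpoly.
        \<forall>y j \<beta>. mfps_coeff (G y $ j) \<beta> =
          mpoly_eval (P j \<beta>) (\<lambda>(i, \<alpha>). mfps_coeff (y $ i) \<alpha>))"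

end

theory Submission
  imports Defs
begin

text \<open>
  By compactness it suffices to show that a system of polynomial equations in countably many
  unknowns over an uncountable algebraically closed field \<open>K\<close> is solvable as soon as all its
  finite subsystems are. The ideal generated by such a system is proper, so it lies in a maximal
  ideal \<open>M\<close>. The quotient by \<open>M\<close> is a field extension of \<open>K\<close> of countable dimension. For
  \<open>t\<close> transcendental the uncountably many elements \<open>1 / (t - a)\<close> would be linearly
  independent; hence the extension is algebraic, i.e. equal to \<open>K\<close>, and the
  classes of the unknowns modulo \<open>M\<close> form a solution.
\<close>

section \<open>Maximal ideals\<close>

text \<open>Ideals are the submodules of a ring over itself, so \<open>ideal.subspace\<close> means
  being an ideal and \<open>ideal.span\<close> is the generated ideal.\<close>

interpretation ideal: module "(*) :: 'a::comm_ring_1 \<Rightarrow> 'a \<Rightarrow> 'a"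
  by (rule module_mult)

\<comment> \<open>This reassociates products to the left and makes the simplifier loop with \<open>mult.assoc\<close>.\<close>
declare ideal.scale_scale [simp del]

definition maximal_ideal :: "'a::comm_ring_1 set \<Rightarrow> bool" where
  "maximal_ideal M \<longleftrightarrow> ideal.subspace M \<and> 1 \<notin> M \<and>
     (\<forall>J. ideal.subspace J \<longrightarrow> 1 \<notin> J \<longrightarrow> M \<subseteq> J \<longrightarrow> J = M)"

lemma maximal_idealD:
  assumes "maximal_ideal M"
  shows maximal_ideal_subspace: "ideal.subspace M" and maximal_ideal_one: "1 \<notin> M"
  using assms by (auto simp: maximal_ideal_def)

text \<open>Zorn's lemma: the union of a chain of proper ideals stays proper because no member
  contains \<open>1\<close>.\<close>

lemma exists_maximal_ideal:
  fixes I :: "'a::comm_ring_1 set"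
  assumes "ideal.subspace I" "1 \<notin> I"
  obtains M where "maximal_ideal M" "I \<subseteq> M"
proof -
  define \<A> where "\<A> = {J. ideal.subspace J \<and> 1 \<notin> J \<and> I \<subseteq> J}"
  have "\<exists>M\<in>\<A>. \<forall>X\<in>\<A>. M \<subseteq> X \<longrightarrow> X = M"
  proof (rule subset_Zorn_nonempty)
    show "\<A> \<noteq> {}" using assms by (auto simp: \<A>_def)
  next
    fix \<C> assume ne: "\<C> \<noteq> {}" and ch: "subset.chain \<A> \<C>"
    have sub: "J \<in> \<A>" if "J \<in> \<C>" for J
      using ch that by (auto simp: subset.chain_def)
    have lin: "J \<subseteq> J' \<or> J' \<subseteq> J" if "J \<in> \<C>" "J' \<in> \<C>" for J J'
      using ch that by (auto simp: subset_chain_def)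
    have "ideal.subspace (\<Union>\<C>)"
    proof (rule ideal.subspaceI)
      show "0 \<in> \<Union>\<C>" using ne sub by (auto simp: \<A>_def ideal.subspace_0)
    next
      fix x y assume "x \<in> \<Union>\<C>" "y \<in> \<Union>\<C>"
      then obtain J where "J \<in> \<C>" "x \<in> J" "y \<in> J"
        using lin by blast
      then show "x + y \<in> \<Union>\<C>" using sub by (auto simp: \<A>_def intro: ideal.subspace_add)
    next
      fix c x assume "x \<in> \<Union>\<C>"
      then show "c * x \<in> \<Union>\<C>" using sub by (auto simp: \<A>_def intro: ideal.subspace_scale)
    qed
    then show "\<Union>\<C> \<in> \<A>" using ne sub by (auto simp: \<A>_def)
  qed
  then obtain M where M: "M \<in> \<A>" "\<forall>X\<in>\<A>. M \<subseteq> X \<longrightarrow> X = M" by blast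
  then have "maximal_ideal M"
    unfolding maximal_ideal_def \<A>_def by blast
  with M(1) show thesis by (auto simp: \<A>_def intro: that)
qed

text \<open>The quotient by \<open>M\<close> is a field, phrased by congruences: the ideal generated
  by \<open>M\<close> and \<open>x\<close> is larger than \<open>M\<close> and so contains
  \<open>1\<close>.\<close>

lemma maximal_ideal_inverse:
  fixes x :: "'a::comm_ring_1"
  assumes M: "maximal_ideal M" and x: "x \<notin> M"
  obtains y where "x * y - 1 \<in> M"
proof -
  note sub = maximal_ideal_subspace[OF M]
  define J where "J = {x * y + m | y m. m \<in> M}"
  have "ideal.subspace J"
  proof (rule ideal.subspaceI)
    have "0 = x * 0 + 0" by simp
    then show "0 \<in> J" using ideal.subspace_0[OF sub] unfolding J_def by blast
  next
    fix u v assume "u \<in> J" "v \<in> J"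
    then obtain y m y' m' where "u = x * y + m" "v = x * y' + m'" "m \<in> M" "m' \<in> M"
      unfolding J_def by blast
    then have "u + v = x * (y + y') + (m + m')" "m + m' \<in> M"
      by (simp_all add: algebra_simps ideal.subspace_add[OF sub])
    then show "u + v \<in> J" unfolding J_def by blast
  next
    fix c u assume "u \<in> J"
    then obtain y m where "u = x * y + m" "m \<in> M" unfolding J_def by blast
    then have "c * u = x * (c * y) + c * m" "c * m \<in> M"
      by (simp_all add: algebra_simps ideal.subspace_scale[OF sub])
    then show "c * u \<in> J" unfolding J_def by blast
  qed
  moreover have "M \<subseteq> J"
  proof
    fix m assume "m \<in> M"
    moreover have "m = x * 0 + m" by simp
    ultimately show "m \<in> J" unfolding J_def by blast
  qed
  moreover have "x \<in> J"
  proof -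
    have "x = x * 1 + 0" by simp
    then show ?thesis using ideal.subspace_0[OF sub] unfolding J_def by blast
  qed
  ultimately have "1 \<in> J" using M x unfolding maximal_ideal_def by blast
  then obtain y m where "1 = x * y + m" and m: "m \<in> M" unfolding J_def by blast
  then have "x * y - 1 = - 1 * m" by (simp add: algebra_simps)
  then have "x * y - 1 \<in> M" using ideal.subspace_scale[OF sub m] by metis
  then show thesis by (rule that)
qed

text \<open>If \<open>z\<close> is not in \<open>M\<close>, multiplying \<open>x * z\<close> by an
  inverse of \<open>z\<close> modulo \<open>M\<close> recovers \<open>x\<close>.\<close>

lemma maximal_ideal_prime:
  fixes x :: "'a::comm_ring_1"
  assumes M: "maximal_ideal M" and xz: "x * z \<in> M"
  shows "x \<in> M \<or> z \<in> M"
proof (rule disjCI)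
  assume "z \<notin> M"
  then obtain y where y: "z * y - 1 \<in> M" using maximal_ideal_inverse[OF M] by blast
  note sub = maximal_ideal_subspace[OF M]
  have "x = y * (x * z) - x * (z * y - 1)" by (simp add: algebra_simps)
  then show "x \<in> M"
    using ideal.subspace_diff[OF sub ideal.subspace_scale[OF sub xz] ideal.subspace_scale[OF sub y]]
    by metis
qed

section \<open>Algebras of countable dimension over an uncountable field\<close>

text \<open>A commutative algebra over the field \<open>'k\<close> with structure map
  \<open>C\<close>. Inside the locale, \<open>span\<close> and \<open>dependent\<close> refer to
  scalars from \<open>'k\<close>, in contrast to \<open>ideal.span\<close>.\<close>

locale field_algebra =
  fixes C :: "'k::field \<Rightarrow> 'r::comm_ring_1"
  assumes C_add: "C (a + b) = C a + C b"
    and C_mult: "C (a * b) = C a * C b"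
    and C_1: "C 1 = 1"
begin

sublocale vector_space "\<lambda>c x. C c * x"
  by unfold_locales (simp_all add: C_add C_mult C_1 algebra_simps)

lemma C_0: "C 0 = 0"
  using C_add[of 0 0] by simp

lemma C_minus: "C (- a) = - C a"
  using C_add[of a "- a"] by (simp add: C_0 eq_neg_iff_add_eq_0 add.commute)

definition poly_at :: "'r \<Rightarrow> 'k poly \<Rightarrow> 'r" where
  "poly_at x p = poly (map_poly C p) x"

lemma poly_at_0 [simp]: "poly_at x 0 = 0"
  by (simp add: poly_at_def)

lemma poly_at_pCons [simp]: "poly_at x (pCons c p) = C c + x * poly_at x p"
  by (simp add: poly_at_def map_poly_pCons C_0)

lemma poly_at_1: "poly_at x 1 = 1"
  by (simp add: one_pCons C_1)

lemma poly_at_add: "poly_at x (p + q) = poly_at x p + poly_at x q"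
proof (induction p arbitrary: q)
  case (pCons a p)
  obtain b r where "q = pCons b r" by (cases q)
  then show ?case by (simp add: pCons.IH C_add algebra_simps)
qed simp

lemma poly_at_smult: "poly_at x (smult c p) = C c * poly_at x p"
  by (induction p) (simp_all add: C_mult algebra_simps)

lemma poly_at_mult: "poly_at x (p * q) = poly_at x p * poly_at x q"
  by (induction p) (simp_all add: poly_at_add poly_at_smult C_0 algebra_simps)

lemma poly_at_sum: "poly_at x (\<Sum>i\<in>A. f i) = (\<Sum>i\<in>A. poly_at x (f i))"
  by (induction A rule: infinite_finite_induct) (simp_all add: poly_at_add)

lemma poly_at_prod: "poly_at x (\<Prod>i\<in>A. f i) = (\<Prod>i\<in>A. poly_at x (f i))"
  by (induction A rule: infinite_finite_induct) (simp_all add: poly_at_mult poly_at_1)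

text \<open>A nonzero constant is a unit and so lies in no proper ideal.\<close>

lemma C_in_maximal_ideal_iff:
  assumes M: "maximal_ideal M"
  shows "C a \<in> M \<longleftrightarrow> a = 0"
proof
  assume "C a \<in> M"
  then have "C (inverse a) * C a \<in> M"
    by (rule ideal.subspace_scale[OF maximal_ideal_subspace[OF M]])
  then show "a = 0"
    using maximal_ideal_one[OF M] by (cases "a = 0") (simp_all add: C_mult[symmetric] C_1)
qed (simp add: C_0 ideal.subspace_0[OF maximal_ideal_subspace[OF M]])

text \<open>Pigeonhole: \<open>B\<close> has only countably many finite subsets, so the span of one
  of them contains \<open>g a\<close> for uncountably many \<open>a\<close>; infinitely many vectors
  in a finite-dimensional space are dependent.\<close>

lemma linearly_dependent_family:
  assumes B: "countable B" "span B = UNIV"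
    and K: "uncountable (UNIV :: 'k set)"
    and inj: "inj (g :: 'k \<Rightarrow> 'r)"
  obtains A c a where "finite A" "a \<in> A" "c a \<noteq> 0" "(\<Sum>a\<in>A. C (c a) * g a) = 0"
proof -
  let ?\<T> = "{T. finite T \<and> T \<subseteq> B}"
  have "UNIV \<subseteq> (\<Union>T\<in>?\<T>. {a. g a \<in> span T})"
  proof
    fix a
    have "g a \<in> span B" using B by simp
    then obtain T r where T: "finite T" "T \<subseteq> B" "g a = (\<Sum>x\<in>T. C (r x) * x)"
      unfolding span_explicit by blast
    have "g a \<in> span T"
      unfolding T(3) by (intro span_sum span_scale span_base)
    then show "a \<in> (\<Union>T\<in>?\<T>. {a. g a \<in> span T})" using T by blast
  qed
  then have "uncountable (\<Union>T\<in>?\<T>. {a. g a \<in> span T})"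
    using K countable_subset by blast
  then have "\<not> (\<forall>T\<in>?\<T>. countable {a. g a \<in> span T})"
    using countable_UN[OF countable_Collect_finite_subset[OF B(1)], of "\<lambda>T. {a. g a \<in> span T}"]
    by (rule contrapos_nn) simp
  then obtain T where T: "finite T" "uncountable {a. g a \<in> span T}" by auto
  then have "infinite {a. g a \<in> span T}" using countable_finite by blast
  then have "infinite (g ` {a. g a \<in> span T})"
    using inj by (metis finite_imageD inj_on_subset subset_UNIV)
  moreover have "g ` {a. g a \<in> span T} \<subseteq> span T" by blast
  ultimately have "dependent (g ` {a. g a \<in> span T})"
    using independent_span_bound[OF T(1)] by blast
  then obtain S u v where S: "finite S" "S \<subseteq> g ` {a. g a \<in> span T}" "v \<in> S" "u v \<noteq> 0"
      "(\<Sum>v\<in>S. C (u v) * v) = 0"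
    unfolding dependent_explicit by blast
  obtain A where A: "finite A" "S = g ` A"
    using finite_subset_image[OF S(1,2)] by blast
  from S(3) A obtain a where "a \<in> A" "v = g a" by blast
  \<comment> \<open>Injectivity of \<open>g\<close> turns the relation among the vectors in
    \<open>S\<close> into one indexed by scalars.\<close>
  moreover have "(\<Sum>a\<in>A. C (u (g a)) * g a) = 0"
    using S(5) unfolding A(2) by (subst (asm) sum.reindex) (auto intro: inj_on_subset[OF inj])
  ultimately show thesis
    using that[of A a "u \<circ> g"] A S(4) by simp
qed

end

text \<open>For \<open>x\<close> not congruent to a constant, the inverses of the
  \<open>x - C a\<close> modulo \<open>M\<close> form an uncountable family; clearing denominators
  in a linear relation between them gives the polynomial.\<close>

lemma (in field_algebra) maximal_ideal_algebraic_element: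
  fixes M :: "'r set"
  assumes M: "maximal_ideal M"
    and B: "countable B" "span B = UNIV"
    and K: "uncountable (UNIV :: 'k set)"
  obtains f where "f \<noteq> 0" "poly_at x f \<in> M"
proof (cases "\<exists>r. x - C r \<in> M")
  case True
  then obtain r where "x - C r \<in> M" by blast
  then have "poly_at x [:-r, 1:] \<in> M" by (simp add: C_minus C_1)
  then show thesis by (intro that[of "[:-r, 1:]"]) simp_all
next
  case False
  note sub = maximal_ideal_subspace[OF M]
  have "\<exists>y. (x - C a) * y - 1 \<in> M" for a
    using maximal_ideal_inverse[OF M] False by metis
  then obtain g where g: "(x - C a) * g a - 1 \<in> M" for a by metis
  \<comment> \<open>Equal inverses would put \<open>C (b - a) * g a\<close>, hence
    \<open>g a\<close>, into \<open>M\<close>, although \<open>g a\<close> is invertible modulo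
    \<open>M\<close>.\<close>
  have "inj g"
  proof (rule injI, rule ccontr)
    fix a b assume eq: "g a = g b" and "a \<noteq> b"
    have "((x - C a) * g a - 1) - ((x - C b) * g a - 1) \<in> M"
      using ideal.subspace_diff[OF sub g[of a] g[of b]] unfolding eq .
    moreover have "((x - C a) * g a - 1) - ((x - C b) * g a - 1) = C (b - a) * g a"
      using C_add[of "b - a" a] by (simp add: algebra_simps)
    ultimately have "C (b - a) * g a \<in> M" by simp
    then have "g a \<in> M"
      using maximal_ideal_prime[OF M, of "C (b - a)" "g a"] C_in_maximal_ideal_iff[OF M] \<open>a \<noteq> b\<close>
      by simp
    then have "(x - C a) * g a \<in> M" by (rule ideal.subspace_scale[OF sub])
    from ideal.subspace_diff[OF sub this g[of a]] show False
      using maximal_ideal_one[OF M] by simp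
  qed
  then obtain A c a where A: "finite A" "a \<in> A" "c a \<noteq> 0" "(\<Sum>a\<in>A. C (c a) * g a) = 0"
    using linearly_dependent_family[OF B K] by metis
  \<comment> \<open>\<open>f\<close> is the numerator of the rational function \<open>\<Sum>a\<in>A. c a / (t - a)\<close>.\<close>
  define f where "f = (\<Sum>a\<in>A. smult (c a) (\<Prod>b\<in>A - {a}. [:-b, 1:]))"
  \<comment> \<open>Every summand with an index other than \<open>a\<close> contains the factor that
    vanishes at \<open>a\<close>.\<close>
  have "poly f a = (\<Sum>a'\<in>{a}. c a' * (\<Prod>b\<in>A - {a'}. a - b))"
    unfolding f_def poly_sum using A(1,2)
    by (intro sum.mono_neutral_cong_right) (auto simp: poly_prod)
  also have "\<dots> \<noteq> 0" using A(1,3) by auto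
  finally have "f \<noteq> 0" by auto
  moreover have "poly_at x f \<in> M"
  proof -
    let ?P = "\<lambda>A. \<Prod>b\<in>A. (x - C b)"
    \<comment> \<open>Applied with \<open>w = x - C a\<close> and \<open>z = g a\<close>: the factor
      missing from \<open>?P (A - {a})\<close> is supplied at the price of \<open>g a\<close>, with
      an error in \<open>M\<close>. The main terms then add up to \<open>?P A\<close> times the
      linear relation, which holds exactly in the ring.\<close>
    have cancel: "u * p = w * p * (u * z) - u * p * (w * z - 1)" for u p w z :: 'r
      by (simp add: algebra_simps)
    have "poly_at x f = (\<Sum>a\<in>A. C (c a) * ?P (A - {a}))"
      by (simp add: f_def poly_at_sum poly_at_smult poly_at_prod C_minus C_1)
    also have "\<dots> = ?P A * (\<Sum>a\<in>A. C (c a) * g a)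
        - (\<Sum>a\<in>A. C (c a) * ?P (A - {a}) * ((x - C a) * g a - 1))"
      unfolding sum_distrib_left sum_subtractf[symmetric]
    proof (rule sum.cong[OF refl])
      fix a assume "a \<in> A"
      then have P: "?P A = (x - C a) * ?P (A - {a})" by (rule prod.remove[OF A(1)])
      show "C (c a) * ?P (A - {a})
          = ?P A * (C (c a) * g a) - C (c a) * ?P (A - {a}) * ((x - C a) * g a - 1)"
        unfolding P by (rule cancel)
    qed
    also have "\<dots> = - (\<Sum>a\<in>A. C (c a) * ?P (A - {a}) * ((x - C a) * g a - 1))"
      by (simp add: A(4))
    also have "\<dots> \<in> M"
      by (intro ideal.subspace_neg[OF sub] ideal.subspace_sum[OF sub] ideal.subspace_scale[OF sub] g)
    finally show ?thesis .
  qed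
  ultimately show thesis by (rule that)
qed

section \<open>The algebraically closed case: the residue field is the base field\<close>

locale alg_closed_field_algebra = field_algebra C
  for C :: "'k::alg_closed_field \<Rightarrow> 'r::comm_ring_1"
begin

text \<open>Linear factors of \<open>f\<close> are split off one at a time. As \<open>M\<close> is
  prime, it contains \<open>x - C r\<close> or the value of the cofactor of smaller degree; the
  descent cannot end at a nonzero constant.\<close>

lemma maximal_ideal_root:
  assumes M: "maximal_ideal M"
  shows "f \<noteq> 0 \<Longrightarrow> poly_at x f \<in> M \<Longrightarrow> \<exists>r. x - C r \<in> M"
proof (induction "degree f" arbitrary: f)
  case 0
  then obtain c where "f = [:c:]" by (metis degree_eq_zeroE)
  then show ?case using 0 C_in_maximal_ideal_iff[OF M] by simp
next
  case (Suc n)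
  then obtain r where "poly f r = 0"
    using alg_closed_imp_poly_has_root[of f] by auto
  then obtain q where q: "f = [:-r, 1:] * q" by (metis dvdE poly_eq_0_iff_dvd)
  with Suc.prems have "q \<noteq> 0" by auto
  then have "n = degree q"
    using Suc.hyps(2) unfolding q by (simp add: degree_mult_eq del: mult_pCons_left)
  moreover have "(x - C r) * poly_at x q \<in> M"
    using Suc.prems(2) unfolding q poly_at_mult by (simp add: C_minus C_1)
  ultimately show ?case
    using maximal_ideal_prime[OF M] Suc.hyps(1) \<open>q \<noteq> 0\<close> by blast
qed

text \<open>A form of the weak Nullstellensatz: every class modulo \<open>M\<close> is represented
  by a constant.\<close>

lemma maximal_ideal_residue:
  assumes "maximal_ideal M" "countable B" "span B = UNIV" "uncountable (UNIV :: 'k set)"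
  obtains r where "x - C r \<in> M"
  using maximal_ideal_algebraic_element[OF assms] maximal_ideal_root[OF assms(1)] by metis

end

section \<open>Polynomials in countably many variables\<close>

abbreviation mono_eval :: "('v \<Rightarrow> 'k::comm_semiring_1) \<Rightarrow> ('v \<Rightarrow>\<^sub>0 nat) \<Rightarrow> 'k" where
  "mono_eval a \<mu> \<equiv> \<Prod>v\<in>Poly_Mapping.keys \<mu>. a v ^ Poly_Mapping.lookup \<mu> v"

text \<open>Surplus variables have exponent \<open>0\<close> and contribute the factor
  \<open>1\<close>, so two monomials can be evaluated over a common index set.\<close>

lemma mono_eval_superset:
  assumes "finite V" "Poly_Mapping.keys \<mu> \<subseteq> V"
  shows "mono_eval a \<mu> = (\<Prod>v\<in>V. a v ^ Poly_Mapping.lookup \<mu> v)"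
  using assms by (intro prod.mono_neutral_left) (auto simp: in_keys_iff)

lemma mono_eval_add: "mono_eval a (\<mu> + \<nu>) = mono_eval a \<mu> * mono_eval a \<nu>"
proof -
  let ?V = "Poly_Mapping.keys \<mu> \<union> Poly_Mapping.keys \<nu>"
  have "mono_eval a (\<mu> + \<nu>) = (\<Prod>v\<in>?V. a v ^ Poly_Mapping.lookup (\<mu> + \<nu>) v)"
    by (intro mono_eval_superset) (use keys_add[of \<mu> \<nu>] in auto)
  also have "\<dots> = (\<Prod>v\<in>?V. a v ^ Poly_Mapping.lookup \<mu> v) * (\<Prod>v\<in>?V. a v ^ Poly_Mapping.lookup \<nu> v)"
    by (simp add: lookup_add power_add prod.distrib)
  also have "\<dots> = mono_eval a \<mu> * mono_eval a \<nu>"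
    by (simp add: mono_eval_superset[of ?V])
  finally show ?thesis .
qed

lemma mpoly_eval_superset:
  assumes "finite V" "Poly_Mapping.keys p \<subseteq> V"
  shows "mpoly_eval p a = (\<Sum>\<mu>\<in>V. Poly_Mapping.lookup p \<mu> * mono_eval a \<mu>)"
  unfolding mpoly_eval_def using assms by (intro sum.mono_neutral_left) (auto simp: in_keys_iff)

lemma mpoly_eval_0 [simp]: "mpoly_eval 0 a = 0"
  by (simp add: mpoly_eval_def)

lemma mpoly_eval_single: "mpoly_eval (Poly_Mapping.single \<mu> c) a = c * mono_eval a \<mu>"
  by (subst mpoly_eval_superset[of "{\<mu>}"]) auto

lemma mpoly_eval_1 [simp]: "mpoly_eval 1 a = 1"
  using mpoly_eval_single[of 0 1 a] by simp

lemma mpoly_eval_add: "mpoly_eval (p + q) a = mpoly_eval p a + mpoly_eval q a"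
proof -
  let ?V = "Poly_Mapping.keys p \<union> Poly_Mapping.keys q"
  have "mpoly_eval (p + q) a = (\<Sum>\<mu>\<in>?V. Poly_Mapping.lookup (p + q) \<mu> * mono_eval a \<mu>)"
    by (intro mpoly_eval_superset) (use keys_add[of p q] in auto)
  also have "\<dots> = mpoly_eval p a + mpoly_eval q a"
    by (simp add: lookup_add distrib_right sum.distrib mpoly_eval_superset[of ?V])
  finally show ?thesis .
qed

lemma update_eq_add_single:
  assumes "k \<notin> Poly_Mapping.keys p"
  shows "Poly_Mapping.update k b p = p + Poly_Mapping.single k b"
  using assms by (intro poly_mapping_eqI)
    (auto simp: lookup_update lookup_add lookup_single in_keys_iff when_def)

text \<open>Additive induction, used at both levels: for monomials as exponent functions and for
  polynomials as coefficient functions.\<close>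

lemma poly_mapping_single_induct [case_names zero add single]:
  assumes "P 0" "\<And>p q. P p \<Longrightarrow> P q \<Longrightarrow> P (p + q)" "\<And>k b. P (Poly_Mapping.single k b)"
  shows "P p"
  using assms by (induction p rule: update_induct) (simp_all add: update_eq_add_single)

text \<open>Both sides are additive in \<open>p\<close> and in \<open>q\<close>, which leaves
  products of two single terms.\<close>

lemma mpoly_eval_mult: "mpoly_eval (p * q) a = mpoly_eval p a * mpoly_eval q a"
proof (induction p rule: poly_mapping_single_induct)
  case (single \<mu> c)
  show ?case
    by (induction q rule: poly_mapping_single_induct)
      (simp_all add: mpoly_eval_add distrib_left distrib_right mult_single mpoly_eval_single mono_eval_add ac_simps)
qed (simp_all add: mpoly_eval_add distrib_right)

abbreviation Const :: "'k::comm_ring_1 \<Rightarrow> ('v, 'k) mpoly" where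
  "Const \<equiv> Poly_Mapping.single 0"

abbreviation Var :: "'v \<Rightarrow> ('v, 'k::comm_ring_1) mpoly" where
  "Var v \<equiv> Poly_Mapping.single (Poly_Mapping.single v 1) 1"

interpretation mpoly: field_algebra "Const :: 'k::field \<Rightarrow> ('v, 'k) mpoly"
  by unfold_locales (simp_all add: single_add mult_single)

interpretation mpoly: alg_closed_field_algebra "Const :: 'k::alg_closed_field \<Rightarrow> ('v, 'k) mpoly"
  by unfold_locales

section \<open>The polynomial ring has countable dimension\<close>

text \<open>A monomial is determined by the graph of its nonzero exponents, a finite subset of a
  countable set.\<close>

lemma countable_UNIV_poly_mapping_nat:
  assumes "countable (UNIV :: 'v set)"
  shows "countable (UNIV :: ('v \<Rightarrow>\<^sub>0 nat) set)"
proof -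
  let ?graph = "\<lambda>\<mu> :: 'v \<Rightarrow>\<^sub>0 nat. (\<lambda>v. (v, Poly_Mapping.lookup \<mu> v)) ` Poly_Mapping.keys \<mu>"
  have "inj ?graph"
  proof (rule injI, rule poly_mapping_eqI)
    fix \<mu> \<nu> v assume eq: "?graph \<mu> = ?graph \<nu>"
    have "(v, n) \<in> ?graph \<rho> \<longleftrightarrow> n \<noteq> 0 \<and> n = Poly_Mapping.lookup \<rho> v" for n \<rho>
      by (auto simp: in_keys_iff)
    with eq show "Poly_Mapping.lookup \<mu> v = Poly_Mapping.lookup \<nu> v" by metis
  qed
  moreover have "countable (range ?graph)"
  proof (rule countable_subset)
    show "range ?graph \<subseteq> {A. finite A \<and> A \<subseteq> UNIV \<times> UNIV}" by auto
    show "countable {A :: ('v \<times> nat) set. finite A \<and> A \<subseteq> UNIV \<times> UNIV}"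
      by (intro countable_Collect_finite_subset countable_SIGMA assms) auto
  qed
  ultimately show ?thesis using countable_image_inj_on by blast
qed

lemma mpoly_span_monomials:
  "mpoly.span (range (\<lambda>\<mu>. Poly_Mapping.single \<mu> (1 :: 'k::field))) = (UNIV :: ('v, 'k) mpoly set)"
proof -
  let ?B = "range (\<lambda>\<mu>. Poly_Mapping.single \<mu> (1 :: 'k)) :: ('v, 'k) mpoly set"
  have "p \<in> mpoly.span ?B" for p
  proof (induction p rule: poly_mapping_single_induct)
    case (single \<mu> c)
    have "Const c * Poly_Mapping.single \<mu> 1 \<in> mpoly.span ?B"
      by (intro mpoly.span_scale mpoly.span_base) simp
    then show ?case by (simp add: mult_single)
  qed (simp_all add: mpoly.span_add mpoly.span_zero)
  then show ?thesis by blast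
qed

section \<open>Congruences in the polynomial ring\<close>

lemma ideal_cong_mult:
  assumes M: "ideal.subspace M" and "x - x' \<in> M" "y - y' \<in> M"
  shows "x * y - x' * y' \<in> M"
proof -
  have "x * y - x' * y' = y * (x - x') + x' * (y - y')" by (simp add: algebra_simps)
  then show ?thesis
    using ideal.subspace_add[OF M ideal.subspace_scale[OF M assms(2), of y]
      ideal.subspace_scale[OF M assms(3), of x']] by simp
qed

lemma ideal_cong_power:
  assumes M: "ideal.subspace M" and "x - x' \<in> M"
  shows "x ^ n - x' ^ n \<in> M"
  by (induction n) (simp_all add: ideal.subspace_0[OF M] ideal_cong_mult[OF M assms(2)])

lemma Var_power: "Var v ^ n = Poly_Mapping.single (Poly_Mapping.single v n) 1"
  by (induction n) (simp_all add: mult_single single_add[symmetric])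

text \<open>Congruences respect sums and products, so replacing \<open>Var v\<close> by
  \<open>a v\<close> propagates from variables to monomials and then to polynomials.\<close>

lemma mpoly_eval_cong_ideal:
  fixes p :: "('v, 'k::comm_ring_1) mpoly"
  assumes M: "ideal.subspace M" and Var: "\<And>v. Var v - Const (a v) \<in> M"
  shows "p - Const (mpoly_eval p a) \<in> M"
proof -
  have mono: "Poly_Mapping.single \<mu> 1 - Const (mono_eval a \<mu>) \<in> M" for \<mu>
  proof (induction \<mu> rule: poly_mapping_single_induct)
    case zero
    then show ?case by (simp add: ideal.subspace_0[OF M])
  next
    case (add \<mu> \<nu>)
    from ideal_cong_mult[OF M this] show ?case
      unfolding mono_eval_add by (simp add: mult_single)
  next
    case (single v n)
    have "(Const (a v) :: ('v, 'k) mpoly) ^ n = Const (a v ^ n)"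
      by (induction n) (simp_all add: mult_single)
    moreover have "mono_eval a (Poly_Mapping.single v n) = a v ^ n"
      by (cases "n = 0") simp_all
    ultimately show ?case
      using ideal_cong_power[OF M Var, of v n] by (simp add: Var_power[simplified])
  qed
  show ?thesis
  proof (induction p rule: poly_mapping_single_induct)
    case zero
    then show ?case by (simp add: ideal.subspace_0[OF M])
  next
    case (add p q)
    from ideal.subspace_add[OF M this] show ?case
      by (simp add: mpoly_eval_add single_add algebra_simps)
  next
    case (single \<mu> c)
    from ideal.subspace_scale[OF M mono, of "Const c" \<mu>] show ?case
      by (simp add: mpoly_eval_single mult_single algebra_simps)
  qed
qed

section \<open>Compactness for countable polynomial systems\<close>

theorem countable_polynomial_system_solvable:
  fixes S :: "('v, 'k::alg_closed_field) mpoly set"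
  assumes V: "countable (UNIV :: 'v set)" and K: "uncountable (UNIV :: 'k set)"
    and fin: "\<And>F. finite F \<Longrightarrow> F \<subseteq> S \<Longrightarrow> \<exists>a. \<forall>p\<in>F. mpoly_eval p a = 0"
  shows "\<exists>a. \<forall>p\<in>S. mpoly_eval p a = 0"
proof -
  \<comment> \<open>A representation of \<open>1\<close> involves only finitely many equations;
    evaluated at a common zero of these it would read 1 = 0.\<close>
  have "1 \<notin> ideal.span S"
  proof
    assume "1 \<in> ideal.span S"
    then obtain F r where F: "finite F" "F \<subseteq> S" and 1: "1 = (\<Sum>p\<in>F. r p * p)"
      unfolding ideal.span_explicit by blast
    obtain a where a: "\<forall>p\<in>F. mpoly_eval p a = 0" using fin[OF F] by blast
    have "mpoly_eval (\<Sum>p\<in>F. r p * p) a = (\<Sum>p\<in>F. mpoly_eval (r p * p) a)"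
      by (induction F rule: infinite_finite_induct) (simp_all add: mpoly_eval_add)
    also have "\<dots> = 0" using a by (simp add: mpoly_eval_mult)
    finally show False by (simp add: 1[symmetric])
  qed
  then obtain M where M: "maximal_ideal M" "ideal.span S \<subseteq> M"
    using exists_maximal_ideal[OF ideal.subspace_span] by blast
  let ?B = "range (\<lambda>\<mu>. Poly_Mapping.single \<mu> 1) :: ('v, 'k) mpoly set"
  have "countable ?B" by (intro countable_image countable_UNIV_poly_mapping_nat V)
  then have "\<exists>r. Var v - Const r \<in> M" for v
    using mpoly.maximal_ideal_residue[OF M(1) _ mpoly_span_monomials K] by metis
  then obtain a where a: "Var v - Const (a v) \<in> M" for v by metis
  have "mpoly_eval p a = 0" if "p \<in> S" for p
  proof -
    have "p \<in> M" using that M(2) ideal.span_base by blast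
    moreover have "p - Const (mpoly_eval p a) \<in> M"
      using maximal_ideal_subspace[OF M(1)] a by (rule mpoly_eval_cong_ideal)
    \<comment> \<open>This difference is the constant \<open>mpoly_eval p a\<close>, and the only
      constant in \<open>M\<close> is zero.\<close>
    ultimately have "p - (p - Const (mpoly_eval p a)) \<in> M"
      by (rule ideal.subspace_diff[OF maximal_ideal_subspace[OF M(1)]])
    then show ?thesis by (simp add: mpoly.C_in_maximal_ideal_iff[OF M(1)])
  qed
  then show ?thesis by blast
qed

section \<open>Powers of the maximal ideal of the power series ring\<close>

abbreviation mdeg :: "nat ^ 'n \<Rightarrow> nat" where
  "mdeg \<alpha> \<equiv> \<Sum>i\<in>UNIV. \<alpha> $ i"

text \<open>Series of order at least \<open>l\<close>: an ideal given by coefficients that contains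
  the \<open>l\<close>-th power of the maximal ideal.\<close>

definition mfps_order_ge :: "nat \<Rightarrow> ('k::comm_ring_1, 'n::finite) mfps set" where
  "mfps_order_ge l = {f. \<forall>\<beta>. mdeg \<beta> < l \<longrightarrow> mfps_coeff f \<beta> = 0}"

text \<open>In a degree below \<open>k + l\<close>, each product of coefficients has a left factor
  of degree below \<open>k\<close> or a right factor of degree below \<open>l\<close>.\<close>

lemma mfps_order_ge_mult:
  assumes "f \<in> mfps_order_ge k" "g \<in> mfps_order_ge l"
  shows "f * g \<in> mfps_order_ge (k + l)"
proof -
  have "mfps_coeff f \<beta> * mfps_coeff g \<gamma> = 0" if "mdeg (\<beta> + \<gamma>) < k + l" for \<beta> \<gamma>
  proof -
    from that have "mdeg \<beta> < k \<or> mdeg \<gamma> < l" by (auto simp: sum.distrib)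
    then show ?thesis using assms by (auto simp: mfps_order_ge_def)
  qed
  then show ?thesis
    by (auto simp: mfps_order_ge_def mfps_coeff_mult intro!: sum.neutral)
qed

lemma subspace_mfps_order_ge: "ideal.subspace (mfps_order_ge l)"
proof (rule ideal.subspaceI)
  fix c f :: "('a, 'b) mfps" assume "f \<in> mfps_order_ge l"
  \<comment> \<open>Every series \<open>c\<close> has order at least \<open>0\<close>.\<close>
  then show "c * f \<in> mfps_order_ge l"
    using mfps_order_ge_mult[of c 0 f l] by (simp add: mfps_order_ge_def)
qed (simp_all add: mfps_order_ge_def)

lemma mfps_maximal_ideal_order_ge:
  "(mfps_maximal_ideal :: ('k::comm_ring_1, 'n::finite) mfps set) \<subseteq> mfps_order_ge 1"
  unfolding mfps_maximal_ideal_def ideal_generated_def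
proof (rule ideal.span_minimal[OF _ subspace_mfps_order_ge])
  show "range mfps_X \<subseteq> (mfps_order_ge 1 :: ('k, 'n) mfps set)"
  proof clarsimp
    fix i :: 'n
    have "mdeg (axis i (1 :: nat)) \<noteq> 0" by (auto simp: axis_def)
    then show "(mfps_X i :: ('k, 'n) mfps) \<in> mfps_order_ge (Suc 0)"
      by (auto simp: mfps_order_ge_def mfps_X_def)
  qed
qed

text \<open>It suffices to look at generators: a product of \<open>l\<close> series without constant
  term has order at least \<open>l\<close>.\<close>

lemma ideal_power_order_ge:
  "ideal_power (mfps_maximal_ideal :: ('k::comm_ring_1, 'n::finite) mfps set) l \<subseteq> mfps_order_ge l"
  unfolding ideal_power_def ideal_generated_def
proof (rule ideal.span_minimal[OF _ subspace_mfps_order_ge])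
  have "set fs \<subseteq> mfps_maximal_ideal \<Longrightarrow> prod_list fs \<in> mfps_order_ge (length fs)"
    for fs :: "('k, 'n) mfps list"
  proof (induction fs)
    case (Cons f fs)
    then show ?case
      using mfps_order_ge_mult[of f 1] mfps_maximal_ideal_order_ge by fastforce
  qed (simp add: mfps_order_ge_def)
  then show "{prod_list fs | fs. length fs = l \<and> set fs \<subseteq> mfps_maximal_ideal}
      \<subseteq> (mfps_order_ge l :: ('k, 'n) mfps set)"
    by blast
qed

section \<open>From polynomial systems to textile maps\<close>

theorem theorem2:
  fixes G :: "('k::alg_closed_field, 'n::finite) mfps ^ 'm \<Rightarrow> ('k, 'n) mfps ^ 'q"
  assumes "uncountable (UNIV :: 'k set)"
    and "textile G"
  shows "\<exists>l :: nat.
    (\<exists>y. vec_cong (G y) 0 (ideal_power mfps_maximal_ideal l)) \<longrightarrow> (\<exists>y'. G y' = 0)"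
\<comment> \<open>If some \<open>l\<close> admits no approximate solution, that \<open>l\<close>
  satisfies the implication vacuously; otherwise an exact solution is constructed.\<close>
proof (cases "\<forall>l. \<exists>y. vec_cong (G y) 0 (ideal_power mfps_maximal_ideal l)")
  case approx: True
  from assms(2) obtain P :: "'q \<Rightarrow> nat ^ 'n \<Rightarrow> ('m \<times> (nat ^ 'n), 'k) mpoly"
    where P: "\<And>y j \<beta>. mfps_coeff (G y $ j) \<beta> =
      mpoly_eval (P j \<beta>) (\<lambda>(i, \<alpha>). mfps_coeff (y $ i) \<alpha>)"
    unfolding textile_def by blast
  \<comment> \<open>The unknowns are the coefficients of \<open>y\<close>; finitely many equations
    concern only coefficients of \<open>G y\<close> of bounded degree.\<close>
  have "\<exists>a. \<forall>p\<in>range (\<lambda>(j, \<beta>). P j \<beta>). mpoly_eval p a = 0"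
  proof (rule countable_polynomial_system_solvable[OF _ assms(1)])
    have "countable ((UNIV :: 'm set) \<times> (UNIV :: (nat ^ 'n) set))"
      by (intro countable_SIGMA) (auto intro: countable_finite)
    then show "countable (UNIV :: ('m \<times> (nat ^ 'n)) set)" by simp
  next
    fix F assume "finite F" "F \<subseteq> range (\<lambda>(j, \<beta>). P j \<beta>)"
    then obtain D where D: "finite D" "F = (\<lambda>(j, \<beta>). P j \<beta>) ` D"
      by (metis finite_subset_image)
    \<comment> \<open>The sum bounds the degree of every exponent in \<open>D\<close>; the successor
      makes the bound strict, since order at least \<open>l\<close> kills only the degrees below
      \<open>l\<close>.\<close>
    define l where "l = Suc (\<Sum>(j, \<beta>)\<in>D. mdeg \<beta>)"
    obtain y where y: "vec_cong (G y) 0 (ideal_power mfps_maximal_ideal l)" using approx by blast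
    have "mpoly_eval (P j \<beta>) (\<lambda>(i, \<alpha>). mfps_coeff (y $ i) \<alpha>) = 0" if "(j, \<beta>) \<in> D" for j \<beta>
    proof -
      have "mdeg \<beta> < l"
        using member_le_sum[OF that, of "\<lambda>(j, \<beta>). mdeg \<beta>"] D(1) by (simp add: l_def)
      moreover have "G y $ j \<in> mfps_order_ge l"
        using y ideal_power_order_ge unfolding vec_cong_def by auto
      ultimately show ?thesis by (simp add: P[symmetric] mfps_order_ge_def)
    qed
    then show "\<exists>a. \<forall>p\<in>F. mpoly_eval p a = 0" unfolding D(2) by fast
  qed
  then obtain a where a: "\<And>j \<beta>. mpoly_eval (P j \<beta>) a = 0" by auto
  \<comment> \<open>Any family of scalars is the coefficient family of a formal power series, so the
    solution \<open>a\<close> is itself a vector of series.\<close>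
  define y' :: "('k, 'n) mfps ^ 'm" where "y' = (\<chi> i. Abs_mfps (\<lambda>\<alpha>. a (i, \<alpha>)))"
  have "(\<lambda>(i, \<alpha>). mfps_coeff (y' $ i) \<alpha>) = a" by (auto simp: y'_def)
  then have "mfps_coeff (G y' $ j) \<beta> = 0" for j \<beta> by (simp add: P a)
  then have "G y' = 0" by (simp add: vec_eq_iff mfps_eqI)
  then show ?thesis by blast
qed blast

end
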